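(* Let $k\ge 5$ be an integer. Every digraph $D$ has a spanning $k$-partite subdigraph $H$ with $d^0_H(x)\ge \frac{k-4}{k}\, d^0_D(x)$ for all $x\in V(D)$.
   Context: Digraphs are finite, without loops or parallel arcs (directed $2$-cycles are allowed). For a vertex $x$ of a digraph $D$, $d^+_D(x)$ and $d^-_D(x)$ denote its out-degree and in-degree, and $d^0_D(x)=\min\{d^+_D(x),d^-_D(x)\}$ is its semi-degree. A subdigraph is spanning if it contains all vertices. A digraph is $k$-partite if its vertex set can be partitioned into $k$ (possibly empty) sets each of which induces no arc. *)

theory Defs
  imports Complex_Main "HOL-Library.Disjoint_Sets" "Graph_Theory.Digraph_Component"
begin

definition semi_degree :: "('a, 'b) pre_digraph \<Rightarrow> 'a \<Rightarrow> nat" where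
  "semi_degree G v = min (out_degree G v) (in_degree G v)"

text \<open>The classes \<open>V i\<close> may be empty, so \<open>k\<close> may exceed the number of vertices.\<close>

definition k_partite :: "nat \<Rightarrow> ('a, 'b) pre_digraph \<Rightarrow> bool" where
  "k_partite k G \<longleftrightarrow>
     (\<exists>V :: nat \<Rightarrow> 'a set.
        (\<Union>i<k. V i) = verts G \<and>
        disjoint_family_on V {..<k} \<and>
        (\<forall>i<k. arcs (G \<restriction> V i) = {}))"

end

theory Submission
  imports Defs "HOL-Library.FuncSet"
begin

text \<open>
  The proof adapts Alon's argument for splitting digraphs.  Let each vertex \<open>i\<close> spread weight
  \<open>1/2\<close> uniformly over its out-neighbours and weight \<open>1/2\<close> uniformly over its in-neighbours; this
  gives a substochastic matrix \<open>a\<close>.  If \<open>u\<close> is a positive vector with \<open>u a \<le> u\<close> and the colouring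
  \<open>f\<close> with \<open>k\<close> colours minimises the total monochromatic weight of \<open>u\<^sub>i a\<^sub>i\<^sub>j\<close>, then recolouring \<open>i\<close>
  cannot help, so the monochromatic part of row \<open>i\<close> is at most \<open>2/k\<close>.  Hence at most a fraction
  \<open>4/k\<close> of the out-arcs, and likewise of the in-arcs, of every vertex is monochromatic, and \<open>H\<close>
  consists of the arcs that are not.  A strictly positive \<open>u\<close> need not exist, but for every
  \<open>\<delta> > 0\<close> a Neumann series provides one with \<open>u a \<le> (1 + \<delta>) u\<close>, which suffices because there are
  only finitely many colourings.
\<close>

section \<open>Almost subinvariant vectors of substochastic matrices\<close>

text \<open>With \<open>c = 1 / (1 + \<delta>)\<close>, the sum \<open>u\<close> of the row vectors
  \<open>c^m 1 a^m\<close> solves \<open>u = 1 + c (u a)\<close>. So \<open>u\<close> is at least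
  \<open>1\<close> on \<open>V\<close>, and \<open>u a = (1 + \<delta>) (u - 1)\<close> there, which
  is below \<open>(1 + \<delta>) u\<close>.\<close>

lemma exists_positive_almost_subinvariant_vector:
  fixes a :: "'a \<Rightarrow> 'a \<Rightarrow> real"
  assumes fin: "finite V" and nonneg: "\<And>i j. a i j \<ge> 0"
    and row: "\<And>i. i \<in> V \<Longrightarrow> (\<Sum>j\<in>V. a i j) \<le> 1" and "\<delta> > 0"
  shows "\<exists>u. (\<forall>i\<in>V. u i > 0) \<and> (\<forall>j\<in>V. (\<Sum>i\<in>V. u i * a i j) \<le> (1 + \<delta>) * u j)"
proof -
  \<comment> \<open>On \<open>V\<close>, \<open>w m\<close> is the all-ones row vector multiplied
    \<open>m\<close> times by \<open>a\<close> from the right.\<close>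
  define w where "w m = ((\<lambda>x j. \<Sum>i\<in>V. x i * a i j) ^^ m) (\<lambda>_. 1)" for m
  define c where "c = 1 / (1 + \<delta>)"
  define u where "u j = (\<Sum>m. c ^ m * w m j)" for j
  have c: "0 < c" "c < 1"
    using \<open>\<delta> > 0\<close> by (auto simp: c_def)
  have w_0: "w 0 j = 1" and w_Suc: "w (Suc m) j = (\<Sum>i\<in>V. w m i * a i j)" for m j
    by (simp_all add: w_def)
  have w_nonneg: "w m j \<ge> 0" for m j
    by (induction m arbitrary: j) (auto simp: w_0 w_Suc nonneg intro!: sum_nonneg)
  \<comment> \<open>Only the rows of \<open>a\<close> are bounded, so a single entry of
    \<open>w m\<close> may grow with \<open>m\<close>. The total mass cannot grow, and by
    nonnegativity it bounds every entry; the series for \<open>u\<close> is thus dominated by a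
    geometric one.\<close>
  have w_sum: "(\<Sum>j\<in>V. w m j) \<le> card V" for m
  proof (induction m)
    case 0
    show ?case by (simp add: w_0)
  next
    case (Suc m)
    have "(\<Sum>j\<in>V. w (Suc m) j) = (\<Sum>i\<in>V. w m i * (\<Sum>j\<in>V. a i j))"
      unfolding w_Suc sum_distrib_left by (rule sum.swap)
    also have "\<dots> \<le> (\<Sum>i\<in>V. w m i * 1)"
      by (intro sum_mono mult_left_mono row w_nonneg)
    finally show ?case using Suc by simp
  qed
  have w_le: "w m j \<le> card V" if "j \<in> V" for m j
    using member_le_sum[OF that, of "w m"] w_nonneg fin w_sum[of m] by force
  have summ: "summable (\<lambda>m. c ^ m * w m j)" if "j \<in> V" for j
  proof (rule summable_comparison_test)
    show "\<exists>N. \<forall>m\<ge>N. norm (c ^ m * w m j) \<le> c ^ m * card V"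
      using c w_le[OF that] w_nonneg by (auto simp: abs_mult intro!: mult_left_mono)
    show "summable (\<lambda>m. c ^ m * card V)"
      using c by (intro summable_mult2 summable_geometric) auto
  qed
  \<comment> \<open>The term for \<open>m = 0\<close> gives the \<open>1\<close>; in the others one
    factor \<open>c\<close> and one multiplication by \<open>a\<close> come out of the
    series.\<close>
  have split: "u j = 1 + c * (\<Sum>i\<in>V. u i * a i j)" if j: "j \<in> V" for j
  proof -
    have "u j = (\<Sum>m. c ^ Suc m * w (Suc m) j) + 1"
      unfolding u_def using suminf_split_head[OF summ[OF j]] by (simp add: w_0)
    also have "(\<Sum>m. c ^ Suc m * w (Suc m) j)
        = (\<Sum>m. \<Sum>i\<in>V. c * ((c ^ m * w m i) * a i j))"
      by (simp add: w_Suc sum_distrib_left mult_ac)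
    also have "\<dots> = (\<Sum>i\<in>V. \<Sum>m. c * ((c ^ m * w m i) * a i j))"
      by (intro suminf_sum summable_mult summable_mult2 summ)
    also have "\<dots> = (\<Sum>i\<in>V. c * (u i * a i j))"
    proof (intro sum.cong refl)
      fix i assume "i \<in> V"
      then have "(\<lambda>m. c * ((c ^ m * w m i) * a i j)) sums (c * (u i * a i j))"
        unfolding u_def by (intro sums_mult sums_mult2 summable_sums summ)
      then show "(\<Sum>m. c * ((c ^ m * w m i) * a i j)) = c * (u i * a i j)"
        by (simp add: sums_iff)
    qed
    finally show ?thesis by (simp add: sum_distrib_left)
  qed
  have u_nonneg: "u j \<ge> 0" if "j \<in> V" for j
    unfolding u_def using c w_nonneg by (intro suminf_nonneg summ that) auto
  have "u j > 0" and "(\<Sum>i\<in>V. u i * a i j) \<le> (1 + \<delta>) * u j" if j: "j \<in> V" for j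
  proof -
    have "(\<Sum>i\<in>V. u i * a i j) \<ge> 0"
      using u_nonneg nonneg by (intro sum_nonneg mult_nonneg_nonneg) auto
    then show "u j > 0"
      using split[OF j] c by (smt (verit) mult_nonneg_nonneg)
    have "(1 + \<delta>) * c = 1"
      using \<open>\<delta> > 0\<close> by (simp add: c_def)
    then have "(1 + \<delta>) * u j = (1 + \<delta>) + (\<Sum>i\<in>V. u i * a i j)"
      by (subst split[OF j]) (simp add: distrib_left flip: mult.assoc)
    then show "(\<Sum>i\<in>V. u i * a i j) \<le> (1 + \<delta>) * u j"
      using \<open>\<delta> > 0\<close> by simp
  qed
  then show ?thesis by blast
qed

section \<open>Colourings with little monochromatic weight\<close>

text \<open>Take a colouring of least monochromatic weight. Recolouring \<open>i\<close> alone
  changes only the pairs containing \<open>i\<close>, so the colour of \<open>i\<close> is one to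
  which \<open>i\<close> sends the least weight, and a minimum over \<open>k\<close> colours is at
  most the average.\<close>

lemma exists_locally_optimal_colouring:
  fixes s :: "'a \<Rightarrow> 'a \<Rightarrow> real" and k :: nat
  assumes fin: "finite V" and "k > 0" and sym: "\<And>i j. s i j = s j i" and diag: "\<And>i. s i i = 0"
  obtains f where "f \<in> V \<rightarrow>\<^sub>E {..<k}"
    and "\<And>i. i \<in> V \<Longrightarrow> k * (\<Sum>j\<in>{j\<in>V. f j = f i}. s i j) \<le> (\<Sum>j\<in>V. s i j)"
proof -
  \<comment> \<open>The vertex set is a parameter so that the part of the weight that avoids
    \<open>i\<close> is again a value of \<open>\<Phi>\<close>.\<close>
  define \<Phi> where "\<Phi> W f = (\<Sum>i\<in>W. \<Sum>j\<in>W. if f i = f j then s i j else 0)"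
    for W and f :: "'a \<Rightarrow> nat"
  have "finite (V \<rightarrow>\<^sub>E {..<k})" "V \<rightarrow>\<^sub>E {..<k} \<noteq> {}"
    using fin \<open>k > 0\<close> by (auto intro: finite_PiE simp: PiE_eq_empty_iff)
  then obtain f where f: "f \<in> V \<rightarrow>\<^sub>E {..<k}" and min: "\<And>g. g \<in> V \<rightarrow>\<^sub>E {..<k} \<Longrightarrow> \<Phi> V f \<le> \<Phi> V g"
    using ex_is_arg_min_if_finite[of "V \<rightarrow>\<^sub>E {..<k}" "\<Phi> V"]
    unfolding is_arg_min_linorder by blast
  show ?thesis
  proof (rule that[OF f])
    fix i assume i: "i \<in> V"
    \<comment> \<open>Row \<open>i\<close> and column \<open>i\<close> contribute equally by
      symmetry, hence the factor 2; the diagonal entry vanishes.\<close>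
    have \<Phi>_remove: "\<Phi> V g = 2 * (\<Sum>j\<in>V-{i}. if g j = g i then s i j else 0) + \<Phi> (V - {i}) g" for g
    proof -
      have row: "(\<Sum>j\<in>V. if g l = g j then s l j else 0)
          = (if g l = g i then s l i else 0) + (\<Sum>j\<in>V-{i}. if g l = g j then s l j else 0)" for l
        using fin i by (subst sum.remove[of V i]) auto
      have "\<Phi> V g = (\<Sum>j\<in>V-{i}. if g i = g j then s i j else 0)
          + (\<Sum>l\<in>V-{i}. (if g l = g i then s l i else 0) + (\<Sum>j\<in>V-{i}. if g l = g j then s l j else 0))"
        unfolding \<Phi>_def by (subst sum.remove[OF fin i], unfold row) (simp add: diag)
      also have "\<dots> = (\<Sum>j\<in>V-{i}. if g i = g j then s i j else 0)
          + (\<Sum>j\<in>V-{i}. if g j = g i then s j i else 0) + \<Phi> (V - {i}) g"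
        by (simp add: sum.distrib \<Phi>_def)
      also have "(\<Sum>j\<in>V-{i}. if g i = g j then s i j else 0) = (\<Sum>j\<in>V-{i}. if g j = g i then s i j else 0)"
        by (intro sum.cong) auto
      also have "(\<Sum>j\<in>V-{i}. if g j = g i then s j i else 0) = (\<Sum>j\<in>V-{i}. if g j = g i then s i j else 0)"
        by (intro sum.cong) (auto simp: sym)
      finally show ?thesis by simp
    qed
    define t where "t c = (\<Sum>j\<in>V-{i}. if f j = c then s i j else 0)" for c
    have own: "t (f i) \<le> t c" if "c < k" for c
    proof -
      have "f(i := c) \<in> V \<rightarrow>\<^sub>E {..<k}"
        using f i that by (auto simp: PiE_iff extensional_def)
      then have le: "\<Phi> V f \<le> \<Phi> V (f(i := c))" by (rule min)
      have rest: "\<Phi> (V - {i}) (f(i := c)) = \<Phi> (V - {i}) f"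
        unfolding \<Phi>_def by (intro sum.cong) auto
      have "(\<Sum>j\<in>V-{i}. if (f(i := c)) j = (f(i := c)) i then s i j else 0) = t c"
        unfolding t_def by (intro sum.cong) auto
      then show ?thesis
        using le by (simp only: \<Phi>_remove rest) (simp add: t_def)
    qed
    \<comment> \<open>Each vertex has exactly one colour below \<open>k\<close>, so the values
      \<open>t c\<close> add up to the whole row of \<open>i\<close>.\<close>
    have "(\<Sum>c<k. t c) = (\<Sum>j\<in>V-{i}. \<Sum>c<k. if f j = c then s i j else 0)"
      unfolding t_def by (rule sum.swap)
    also have "\<dots> = (\<Sum>j\<in>V-{i}. s i j)"
      using f by (intro sum.cong) (auto simp: PiE_iff)
    also have "\<dots> = (\<Sum>j\<in>V. s i j)"
      using sum.remove[OF fin i, of "s i"] by (simp add: diag)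
    finally have "k * t (f i) \<le> (\<Sum>j\<in>V. s i j)"
      using sum_mono[of "{..<k}" "\<lambda>_. t (f i)" t] own by simp
    also have "t (f i) = (\<Sum>j\<in>V. if f j = f i then s i j else 0)"
      using sum.remove[OF fin i, of "\<lambda>j. if f j = f i then s i j else 0"] by (simp add: t_def diag)
    also have "\<dots> = (\<Sum>j\<in>{j\<in>V. f j = f i}. s i j)"
      using fin by (rule sum.inter_filter[symmetric])
    finally show "k * (\<Sum>j\<in>{j\<in>V. f j = f i}. s i j) \<le> (\<Sum>j\<in>V. s i j)" .
  qed
qed

text \<open>Local optimality needs symmetric weights, so \<open>u i * a i j\<close> is symmetrised
  to \<open>s\<close>. Row \<open>i\<close> of \<open>s\<close> is row \<open>i\<close> of
  \<open>a\<close> times \<open>u i\<close> plus a column sum, at most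
  \<open>u i + (1 + \<delta>) * u i\<close> in total. Dropping the column part on the monochromatic
  side and cancelling \<open>u i > 0\<close> gives the bound.\<close>

lemma exists_almost_balanced_colouring:
  fixes a :: "'a \<Rightarrow> 'a \<Rightarrow> real" and k :: nat
  assumes fin: "finite V" and "k > 0" and nonneg: "\<And>i j. a i j \<ge> 0" and diag: "\<And>i. a i i = 0"
    and row: "\<And>i. i \<in> V \<Longrightarrow> (\<Sum>j\<in>V. a i j) \<le> 1" and "\<delta> > 0"
  obtains f where "f \<in> V \<rightarrow>\<^sub>E {..<k}"
    and "\<And>i. i \<in> V \<Longrightarrow> (\<Sum>j\<in>{j\<in>V. f j = f i}. a i j) \<le> (2 + \<delta>) / k"
proof -
  obtain u where pos: "\<And>i. i \<in> V \<Longrightarrow> u i > 0"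
    and col: "\<And>j. j \<in> V \<Longrightarrow> (\<Sum>i\<in>V. u i * a i j) \<le> (1 + \<delta>) * u j"
    using exists_positive_almost_subinvariant_vector[of V a, OF fin nonneg row \<open>\<delta> > 0\<close>] by blast
  define s where "s i j = u i * a i j + u j * a j i" for i j
  obtain f where f: "f \<in> V \<rightarrow>\<^sub>E {..<k}"
    and opt: "\<And>i. i \<in> V \<Longrightarrow> k * (\<Sum>j\<in>{j\<in>V. f j = f i}. s i j) \<le> (\<Sum>j\<in>V. s i j)"
    using exists_locally_optimal_colouring[of V k s] fin \<open>k > 0\<close>
    by (auto simp: s_def diag add.commute)
  show ?thesis
  proof (rule that[OF f])
    fix i assume i: "i \<in> V"
    have "k * (u i * (\<Sum>j\<in>{j\<in>V. f j = f i}. a i j)) \<le> k * (\<Sum>j\<in>{j\<in>V. f j = f i}. s i j)"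
      unfolding sum_distrib_left[of "u i"] s_def
      using nonneg pos by (intro mult_left_mono sum_mono) (auto simp: less_imp_le)
    also have "\<dots> \<le> u i * (\<Sum>j\<in>V. a i j) + (\<Sum>j\<in>V. u j * a j i)"
      using opt[OF i] by (simp add: s_def sum.distrib sum_distrib_left)
    also have "\<dots> \<le> u i * 1 + (1 + \<delta>) * u i"
      using pos[OF i] by (intro add_mono mult_left_mono row col i) simp
    also have "\<dots> = u i * (2 + \<delta>)"
      by (simp add: algebra_simps)
    finally have "u i * (k * (\<Sum>j\<in>{j\<in>V. f j = f i}. a i j)) \<le> u i * (2 + \<delta>)"
      by (simp add: mult.left_commute)
    then have "k * (\<Sum>j\<in>{j\<in>V. f j = f i}. a i j) \<le> 2 + \<delta>"
      using pos[OF i] by (simp only: mult_le_cancel_left_pos)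
    then show "(\<Sum>j\<in>{j\<in>V. f j = f i}. a i j) \<le> (2 + \<delta>) / k"
      using \<open>k > 0\<close> by (simp add: field_simps)
  qed
qed

text \<open>The error is removed by a limit: among finitely many colourings, one must work for
  arbitrarily small \<open>\<delta>\<close>.\<close>

lemma exists_balanced_colouring:
  fixes a :: "'a \<Rightarrow> 'a \<Rightarrow> real" and k :: nat
  assumes fin: "finite V" and "k > 0" and nonneg: "\<And>i j. a i j \<ge> 0" and diag: "\<And>i. a i i = 0"
    and row: "\<And>i. i \<in> V \<Longrightarrow> (\<Sum>j\<in>V. a i j) \<le> 1"
  obtains f where "f \<in> V \<rightarrow>\<^sub>E {..<k}"
    and "\<And>i. i \<in> V \<Longrightarrow> (\<Sum>j\<in>{j\<in>V. f j = f i}. a i j) \<le> 2 / k"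
proof -
  define good where "good \<delta> f \<longleftrightarrow> (\<forall>i\<in>V. (\<Sum>j\<in>{j\<in>V. f j = f i}. a i j) \<le> (2 + \<delta>) / k)"
    for \<delta> :: real and f :: "'a \<Rightarrow> nat"
  have "finite (V \<rightarrow>\<^sub>E {..<k})"
    using fin by (intro finite_PiE) auto
  moreover have "\<exists>f\<in>V \<rightarrow>\<^sub>E {..<k}. good (1 / Suc n) f" for n
  proof -
    have "1 / real (Suc n) > 0" by simp
    then obtain f where f: "f \<in> V \<rightarrow>\<^sub>E {..<k}"
      and le: "\<And>i. i \<in> V \<Longrightarrow> (\<Sum>j\<in>{j\<in>V. f j = f i}. a i j) \<le> (2 + 1 / real (Suc n)) / k"
      using exists_almost_balanced_colouring[OF fin \<open>k > 0\<close> nonneg diag row] by blast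
    have "good (1 / Suc n) f"
      unfolding good_def using le by (rule ballI)
    with f show ?thesis by blast
  qed
  \<comment> \<open>Pigeonhole: as the set of colourings is finite, the existential quantifier over
    \<open>f\<close> can be moved in front of "infinitely often".\<close>
  then have "\<exists>\<^sub>F n in sequentially. \<exists>f\<in>V \<rightarrow>\<^sub>E {..<k}. good (1 / Suc n) f"
    by (simp add: frequently_const_iff)
  ultimately obtain f where f: "f \<in> V \<rightarrow>\<^sub>E {..<k}"
    and freq: "\<exists>\<^sub>F n in sequentially. good (1 / Suc n) f"
    by (auto simp: frequently_bex_finite_distrib)
  show ?thesis
  proof (rule that[OF f])
    fix i assume i: "i \<in> V"
    show "(\<Sum>j\<in>{j\<in>V. f j = f i}. a i j) \<le> 2 / k" (is "?S \<le> _")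
    proof (rule ccontr)
      \<comment> \<open>A strict violation of the limiting bound would violate the bounds for all
        large \<open>n\<close> as well.\<close>
      assume "\<not> ?S \<le> 2 / k"
      moreover have "(\<lambda>n. (2 + 1 / Suc n) / k) \<longlonglongrightarrow> (2 + 0) / k"
        by (intro tendsto_intros LIMSEQ_Suc[OF lim_1_over_n] filterlim_compose[OF lim_1_over_n])
          (use \<open>k > 0\<close> in auto)
      ultimately have "\<forall>\<^sub>F n in sequentially. (2 + 1 / Suc n) / k < ?S"
        by (intro order_tendstoD) auto
      then have "\<forall>\<^sub>F n in sequentially. \<not> good (1 / Suc n) f"
        by (rule eventually_mono) (use i in \<open>auto simp: good_def not_le\<close>)
      with freq show False
        by (simp add: frequently_def)
    qed
  qed
qed

section \<open>From matrices to arcs of a digraph\<close>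

lemma sum_card_fibres:
  assumes "finite A" "finite W"
  shows "(\<Sum>j\<in>W. card {e\<in>A. g e = j}) = card {e\<in>A. g e \<in> W}"
proof -
  have "(\<Sum>j\<in>W. card {e\<in>A. g e = j}) = card (\<Union>j\<in>W. {e\<in>A. g e = j})"
    using assms by (intro card_UN_disjoint[symmetric]) auto
  also have "(\<Union>j\<in>W. {e\<in>A. g e = j}) = {e\<in>A. g e \<in> W}"
    by auto
  finally show ?thesis .
qed

text \<open>The bound \<open>2 / k\<close> on the monochromatic part of a row holds for each of its
  two nonnegative halves. A half carries total weight at most \<open>1/2\<close>, so relative to the
  degree the bound doubles to \<open>4 / k\<close>.\<close>

lemma (in digraph) exists_colouring_few_monochromatic_arcs:
  fixes k :: nat
  assumes "k > 0"
  obtains f where "f \<in> verts G \<rightarrow>\<^sub>E {..<k}"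
    and "\<And>x. x \<in> verts G \<Longrightarrow> card {e\<in>out_arcs G x. f (head G e) = f x} \<le> 4 / k * out_degree G x"
    and "\<And>x. x \<in> verts G \<Longrightarrow> card {e\<in>in_arcs G x. f (tail G e) = f x} \<le> 4 / k * in_degree G x"
proof -
  \<comment> \<open>If a degree is zero, division by zero makes that half of the row zero, so row
    sums are at most 1 but need not equal 1.\<close>
  define a where "a i j = card {e\<in>out_arcs G i. head G e = j} / (2 * out_degree G i)
    + card {e\<in>in_arcs G i. tail G e = j} / (2 * in_degree G i)" for i j
  have a_sum: "(\<Sum>j\<in>{j\<in>verts G. P j}. a i j)
      = card {e\<in>out_arcs G i. P (head G e)} / (2 * out_degree G i)
        + card {e\<in>in_arcs G i. P (tail G e)} / (2 * in_degree G i)" for P i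
  proof -
    have "card {e\<in>out_arcs G i. P (head G e)}
        = (\<Sum>j\<in>{j\<in>verts G. P j}. card {e\<in>out_arcs G i. head G e = j})"
      by (subst sum_card_fibres) (auto intro!: arg_cong[where f = card])
    moreover have "card {e\<in>in_arcs G i. P (tail G e)}
        = (\<Sum>j\<in>{j\<in>verts G. P j}. card {e\<in>in_arcs G i. tail G e = j})"
      by (subst sum_card_fibres) (auto intro!: arg_cong[where f = card])
    ultimately show ?thesis
      by (simp only: a_def sum.distrib sum_divide_distrib of_nat_sum)
  qed
  have diag: "a i i = 0" for i
  proof -
    have "{e\<in>out_arcs G i. head G e = i} = {}" "{e\<in>in_arcs G i. tail G e = i} = {}"
      by (auto dest: no_loops)
    then show ?thesis
      by (simp only: a_def card.empty of_nat_0 div_0 add_0_left)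
  qed
  have row: "(\<Sum>j\<in>verts G. a i j) \<le> 1" for i
    using a_sum[where P = "\<lambda>_. True" and i = i]
    by (simp add: in_degree_def out_degree_def flip: in_arcs_def out_arcs_def)
  obtain f where f: "f \<in> verts G \<rightarrow>\<^sub>E {..<k}"
    and bal: "\<And>i. i \<in> verts G \<Longrightarrow> (\<Sum>j\<in>{j\<in>verts G. f j = f i}. a i j) \<le> 2 / k"
    using exists_balanced_colouring[of "verts G" k a] diag row \<open>k > 0\<close> by (auto simp: a_def)
  \<comment> \<open>Here \<open>m\<close> of the \<open>n\<close> arcs on one side are monochromatic
    and \<open>c\<close> is the other half of the row. For \<open>n = 0\<close> the quotient says
    nothing, and \<open>m \<le> n\<close> is what forces \<open>m = 0\<close>.\<close>
  have bound: "m \<le> 4 / k * n" if "m \<le> n" "m / (2 * n) + c \<le> 2 / k" "c \<ge> 0" for m n :: nat and c :: real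
  proof (cases "n = 0")
    case False
    moreover have "m / (2 * n) \<le> 2 / k"
      using that by linarith
    ultimately show ?thesis
      using \<open>k > 0\<close> by (simp add: field_simps)
  qed (use that in simp)
  show ?thesis
  proof (rule that[OF f])
    fix x assume x: "x \<in> verts G"
    note b = bal[OF x, unfolded a_sum]
    show "card {e\<in>out_arcs G x. f (head G e) = f x} \<le> 4 / k * out_degree G x"
      by (rule bound[OF _ b]) (auto simp: out_degree_def intro!: card_mono)
    show "card {e\<in>in_arcs G x. f (tail G e) = f x} \<le> 4 / k * in_degree G x"
      by (rule bound[OF _ ord_eq_le_trans[OF add.commute b]])
        (auto simp: in_degree_def intro!: card_mono)
  qed
qed

section \<open>The subdigraph of bichromatic arcs\<close>

theorem theorem7p7:
  fixes k :: nat and D :: "('a, 'b) pre_digraph"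
  assumes "k \<ge> 5" and "digraph D"
  shows "\<exists>H. spanning H D \<and> k_partite k H \<and>
    (\<forall>x\<in>verts D. real (semi_degree H x) \<ge> (real k - 4) / real k * real (semi_degree D x))"
proof -
  interpret digraph D by fact
  have "k > 0" using \<open>k \<ge> 5\<close> by simp
  then obtain f where f: "f \<in> verts D \<rightarrow>\<^sub>E {..<k}"
    and out: "\<And>x. x \<in> verts D \<Longrightarrow>
      card {e\<in>out_arcs D x. f (head D e) = f x} \<le> 4 / k * out_degree D x"
    and in_: "\<And>x. x \<in> verts D \<Longrightarrow>
      card {e\<in>in_arcs D x. f (tail D e) = f x} \<le> 4 / k * in_degree D x"
    by (rule exists_colouring_few_monochromatic_arcs) blast
  define H where "H = D\<lparr>arcs := {e\<in>arcs D. f (tail D e) \<noteq> f (head D e)}\<rparr>"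
  have "spanning H D"
    unfolding spanning_def
    by (auto simp: H_def compatible_def wf_digraph_axioms intro!: subgraphI wf_digraph.intro)
  moreover have "k_partite k H"
    unfolding k_partite_def
  proof (intro exI[of _ "\<lambda>c. {v\<in>verts D. f v = c}"] conjI allI impI)
    show "(\<Union>c<k. {v\<in>verts D. f v = c}) = verts H"
      using f by (auto simp: H_def PiE_iff)
    show "disjoint_family_on (\<lambda>c. {v\<in>verts D. f v = c}) {..<k}"
      by (auto simp: disjoint_family_on_def)
  qed (auto simp: H_def)
  moreover have "(real k - 4) / k * semi_degree D x \<le> semi_degree H x" if x: "x \<in> verts D" for x
  proof -
    have out_H: "out_degree H x = out_degree D x - card {e\<in>out_arcs D x. f (head D e) = f x}"
    proof -
      have "out_arcs H x = out_arcs D x - {e\<in>out_arcs D x. f (head D e) = f x}"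
        by (auto simp: H_def out_arcs_def)
      then have "out_degree H x = card (out_arcs D x - {e\<in>out_arcs D x. f (head D e) = f x})"
        by (simp only: out_degree_def)
      also have "\<dots> = out_degree D x - card {e\<in>out_arcs D x. f (head D e) = f x}"
        unfolding out_degree_def by (rule card_Diff_subset) auto
      finally show ?thesis .
    qed
    have in_H: "in_degree H x = in_degree D x - card {e\<in>in_arcs D x. f (tail D e) = f x}"
    proof -
      have "in_arcs H x = in_arcs D x - {e\<in>in_arcs D x. f (tail D e) = f x}"
        by (auto simp: H_def in_arcs_def)
      then have "in_degree H x = card (in_arcs D x - {e\<in>in_arcs D x. f (tail D e) = f x})"
        by (simp only: in_degree_def)
      also have "\<dots> = in_degree D x - card {e\<in>in_arcs D x. f (tail D e) = f x}"
        unfolding in_degree_def by (rule card_Diff_subset) auto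
      finally show ?thesis .
    qed
    have ratio: "(real k - 4) / k = 1 - 4 / k"
      using \<open>k > 0\<close> by (simp add: field_simps)
    \<comment> \<open>The subtraction in \<open>out_H\<close> and \<open>in_H\<close> is truncated,
      which is harmless: \<open>real (m - n)\<close> is at least
      \<open>real m - real n\<close>.\<close>
    have "(real k - 4) / k * out_degree D x \<le> out_degree H x"
      "(real k - 4) / k * in_degree D x \<le> in_degree H x"
      using out[OF x] in_[OF x] unfolding out_H in_H ratio left_diff_distrib by linarith+
    \<comment> \<open>From \<open>k \<ge> 5\<close> the factor is nonnegative, so multiplying by it
      preserves the comparison of the minimum with each degree.\<close>
    moreover have "(real k - 4) / k * semi_degree D x \<le> (real k - 4) / k * out_degree D x"
      "(real k - 4) / k * semi_degree D x \<le> (real k - 4) / k * in_degree D x"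
      using \<open>k \<ge> 5\<close>
      by (simp_all only: semi_degree_def) (intro mult_left_mono divide_nonneg_nonneg; simp)+
    ultimately show ?thesis
      by (auto simp: semi_degree_def min_def)
  qed
  ultimately show ?thesis by blast
qed

end
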